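(* Let $\mathbb{L}=(\mathcal{L},\Omega,\models)$ be a disjunctive logic. Then every base change operator for $\mathbb{L}$ satisfying (G1)--(G6) is total preorder representable.
   Context: A logic is a triple $\mathbb{L}=(\mathcal{L},\Omega,\models)$, where $\mathcal{L}$ is a (possibly infinite) set of sentences, $\Omega$ is a (possibly infinite) class of interpretations, and $\models$ is an arbitrary binary relation between $\Omega$ and $\mathcal{L}$. No further requirements are imposed. A belief base is a finite subset of $\mathcal{L}$; $\mathcal{P}_{\mathrm{fin}}(\mathcal{L})$ is the set of belief bases. For $\varphi\in\mathcal{L}$, $[\![\varphi]\!]=\{\omega\in\Omega\mid\omega\models\varphi\}$; for a belief base $\mathcal{K}$, $[\![\mathcal{K}]\!]=\bigcap_{\varphi\in\mathcal{K}}[\![\varphi]\!]$ (so $[\![\emptyset]\!]=\Omega$), and $\omega\models\mathcal{K}$ means $\omega\in[\![\mathcal{K}]\!]$. For belief bases, $\mathcal{K}\models\mathcal{K}'$ means $[\![\mathcal{K}]\!]\subseteq[\![\mathcal{K}']\!]$, and $\mathcal{K}\equiv\mathcal{K}'$ means $[\![\mathcal{K}]\!]=[\![\mathcal{K}']\!]$. A base change operator for $\mathbb{L}$ is a function $\circ:\mathcal{P}_{\mathrm{fin}}(\mathcal{L})\times\mathcal{P}_{\mathrm{fin}}(\mathcal{L})\to\mathcal{P}_{\mathrm{fin}}(\mathcal{L})$. The logic $\mathbb{L}$ is disjunctive if for every two belief bases $\Gamma_1,\Gamma_2$ there is a belief base $\Gamma_1\vee\Gamma_2$ such that $[\![\Gamma_1\vee\Gamma_2]\!]=[\![\Gamma_1]\!]\cup[\![\Gamma_2]\!]$.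 Postulates (for all belief bases $\mathcal{K},\mathcal{K}_1,\mathcal{K}_2,\Gamma,\Gamma_1,\Gamma_2$): (G1) $\mathcal{K}\circ\Gamma\models\Gamma$. (G2) If $[\![\mathcal{K}\cup\Gamma]\!]\neq\emptyset$ then $\mathcal{K}\circ\Gamma\equiv\mathcal{K}\cup\Gamma$. (G3) If $[\![\Gamma]\!]\neq\emptyset$ then $[\![\mathcal{K}\circ\Gamma]\!]\neq\emptyset$. (G4) If $\mathcal{K}_1\equiv\mathcal{K}_2$ and $\Gamma_1\equiv\Gamma_2$ then $\mathcal{K}_1\circ\Gamma_1\equiv\mathcal{K}_2\circ\Gamma_2$. (G5) $(\mathcal{K}\circ\Gamma_1)\cup\Gamma_2\models\mathcal{K}\circ(\Gamma_1\cup\Gamma_2)$. (G6) If $[\![(\mathcal{K}\circ\Gamma_1)\cup\Gamma_2]\!]\neq\emptyset$ then $\mathcal{K}\circ(\Gamma_1\cup\Gamma_2)\models(\mathcal{K}\circ\Gamma_1)\cup\Gamma_2$. For a binary relation $\preceq$ over $\Omega$: $\preceq$ is total if for all $\omega_1,\omega_2\in\Omega$, $\omega_1\preceq\omega_2$ or $\omega_2\preceq\omega_1$; $\omega_1\prec\omega_2$ means $\omega_1\preceq\omega_2$ and $\omega_2\not\preceq\omega_1$; for $\Omega'\subseteq\Omega$, $\min(\Omega',\preceq)=\{\omega\in\Omega'\mid\omega\preceq\omega'\text{ for all }\omega'\in\Omega'\}$. The relation $\preceq$ is min-complete if $\min([\![\Gamma]\!],\preceq)\neq\emptyset$ for every belief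 base $\Gamma$ with $[\![\Gamma]\!]\neq\emptyset$. A preorder is a reflexive and transitive relation. An assignment is a function $\preceq_{(\cdot)}$ assigning to each belief base $\mathcal{K}$ a total binary relation $\preceq_{\mathcal{K}}$ over $\Omega$. It is a preorder assignment (resp. min-complete) if every $\preceq_{\mathcal{K}}$ is a preorder (resp. min-complete). It is faithful if for all belief bases $\mathcal{K},\mathcal{K}'$ and all $\omega,\omega'\in\Omega$: (F1) if $\omega,\omega'\models\mathcal{K}$, then $\omega\prec_{\mathcal{K}}\omega'$ does not hold; (F2) if $\omega\models\mathcal{K}$ and $\omega'\not\models\mathcal{K}$, then $\omega\prec_{\mathcal{K}}\omega'$; (F3) if $\mathcal{K}\equiv\mathcal{K}'$, then ${\preceq_{\mathcal{K}}}={\preceq_{\mathcal{K}'}}$. A base change operator $\circ$ is compatible with $\preceq_{(\cdot)}$ if $[\![\mathcal{K}\circ\Gamma]\!]=\min([\![\Gamma]\!],\preceq_{\mathcal{K}})$ for all belief bases $\mathcal{K},\Gamma$. A base change operator $\circ$ is total preorder representable if there is a min-complete faithful preorder assignment with which $\circ$ is compatible. *)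

theory Defs
  imports Main
begin

text \<open>
  Sentences and interpretations are given by carrier sets inside arbitrary types, so both may be
  empty. Values of \<open>satisfies\<close> outside the carriers are never consulted.
\<close>

record ('s, 'w) logic =
  sentences :: "'s set"
  interpretations :: "'w set"
  satisfies :: "'w \<Rightarrow> 's \<Rightarrow> bool"

definition belief_bases :: "('s, 'w) logic \<Rightarrow> 's set set" where
  "belief_bases L = {K. K \<subseteq> sentences L \<and> finite K}"

definition models_sentence :: "('s, 'w) logic \<Rightarrow> 's \<Rightarrow> 'w set" where
  "models_sentence L \<phi> = {\<omega> \<in> interpretations L. satisfies L \<omega> \<phi>}"

text \<open>The outer intersection makes the empty base have all interpretations as models.\<close>

definition models :: "('s, 'w) logic \<Rightarrow> 's set \<Rightarrow> 'w set" where
  "models L K = interpretations L \<inter> (\<Inter>\<phi>\<in>K. models_sentence L \<phi>)"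

definition base_entails :: "('s, 'w) logic \<Rightarrow> 's set \<Rightarrow> 's set \<Rightarrow> bool" where
  "base_entails L K K' \<longleftrightarrow> models L K \<subseteq> models L K'"

definition base_equiv :: "('s, 'w) logic \<Rightarrow> 's set \<Rightarrow> 's set \<Rightarrow> bool" where
  "base_equiv L K K' \<longleftrightarrow> models L K = models L K'"

definition disjunctive :: "('s, 'w) logic \<Rightarrow> bool" where
  "disjunctive L \<longleftrightarrow>
    (\<forall>\<Gamma>1\<in>belief_bases L. \<forall>\<Gamma>2\<in>belief_bases L.
      \<exists>\<Gamma>\<in>belief_bases L. models L \<Gamma> = models L \<Gamma>1 \<union> models L \<Gamma>2)"

text \<open>
  Operators and assignments are total HOL functions of which only the values on belief bases matter.
\<close>

type_synonym 's base_op = "'s set \<Rightarrow> 's set \<Rightarrow> 's set"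

definition base_change_operator :: "('s, 'w) logic \<Rightarrow> 's base_op \<Rightarrow> bool" where
  "base_change_operator L chg \<longleftrightarrow>
    (\<forall>K\<in>belief_bases L. \<forall>\<Gamma>\<in>belief_bases L. chg K \<Gamma> \<in> belief_bases L)"

definition G1 :: "('s, 'w) logic \<Rightarrow> 's base_op \<Rightarrow> bool" where
  "G1 L chg \<longleftrightarrow>
    (\<forall>K\<in>belief_bases L. \<forall>\<Gamma>\<in>belief_bases L. base_entails L (chg K \<Gamma>) \<Gamma>)"

definition G2 :: "('s, 'w) logic \<Rightarrow> 's base_op \<Rightarrow> bool" where
  "G2 L chg \<longleftrightarrow>
    (\<forall>K\<in>belief_bases L. \<forall>\<Gamma>\<in>belief_bases L.
      models L (K \<union> \<Gamma>) \<noteq> {} \<longrightarrow> base_equiv L (chg K \<Gamma>) (K \<union> \<Gamma>))"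

definition G3 :: "('s, 'w) logic \<Rightarrow> 's base_op \<Rightarrow> bool" where
  "G3 L chg \<longleftrightarrow>
    (\<forall>K\<in>belief_bases L. \<forall>\<Gamma>\<in>belief_bases L.
      models L \<Gamma> \<noteq> {} \<longrightarrow> models L (chg K \<Gamma>) \<noteq> {})"

definition G4 :: "('s, 'w) logic \<Rightarrow> 's base_op \<Rightarrow> bool" where
  "G4 L chg \<longleftrightarrow>
    (\<forall>K1\<in>belief_bases L. \<forall>K2\<in>belief_bases L. \<forall>\<Gamma>1\<in>belief_bases L. \<forall>\<Gamma>2\<in>belief_bases L.
      base_equiv L K1 K2 \<and> base_equiv L \<Gamma>1 \<Gamma>2 \<longrightarrow> base_equiv L (chg K1 \<Gamma>1) (chg K2 \<Gamma>2))"

definition G5 :: "('s, 'w) logic \<Rightarrow> 's base_op \<Rightarrow> bool" where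
  "G5 L chg \<longleftrightarrow>
    (\<forall>K\<in>belief_bases L. \<forall>\<Gamma>1\<in>belief_bases L. \<forall>\<Gamma>2\<in>belief_bases L.
      base_entails L (chg K \<Gamma>1 \<union> \<Gamma>2) (chg K (\<Gamma>1 \<union> \<Gamma>2)))"

definition G6 :: "('s, 'w) logic \<Rightarrow> 's base_op \<Rightarrow> bool" where
  "G6 L chg \<longleftrightarrow>
    (\<forall>K\<in>belief_bases L. \<forall>\<Gamma>1\<in>belief_bases L. \<forall>\<Gamma>2\<in>belief_bases L.
      models L (chg K \<Gamma>1 \<union> \<Gamma>2) \<noteq> {} \<longrightarrow>
      base_entails L (chg K (\<Gamma>1 \<union> \<Gamma>2)) (chg K \<Gamma>1 \<union> \<Gamma>2))"

text \<open>
  A pair \<open>(\<omega>1, \<omega>2)\<close> in a relation means that \<open>\<omega>1\<close> is below or equivalent to \<open>\<omega>2\<close>.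
  Unlike \<^const>\<open>total_on\<close>, totality is required for equal arguments, too, so it includes reflexivity.
\<close>

definition total_rel_on :: "'w set \<Rightarrow> 'w rel \<Rightarrow> bool" where
  "total_rel_on \<Omega> r \<longleftrightarrow>
    r \<subseteq> \<Omega> \<times> \<Omega> \<and> (\<forall>\<omega>1\<in>\<Omega>. \<forall>\<omega>2\<in>\<Omega>. (\<omega>1, \<omega>2) \<in> r \<or> (\<omega>2, \<omega>1) \<in> r)"

definition strictly_below :: "'w rel \<Rightarrow> 'w \<Rightarrow> 'w \<Rightarrow> bool" where
  "strictly_below r \<omega>1 \<omega>2 \<longleftrightarrow> (\<omega>1, \<omega>2) \<in> r \<and> (\<omega>2, \<omega>1) \<notin> r"

definition min_set :: "'w set \<Rightarrow> 'w rel \<Rightarrow> 'w set" where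
  "min_set A r = {\<omega> \<in> A. \<forall>\<omega>'\<in>A. (\<omega>, \<omega>') \<in> r}"

definition min_complete :: "('s, 'w) logic \<Rightarrow> 'w rel \<Rightarrow> bool" where
  "min_complete L r \<longleftrightarrow>
    (\<forall>\<Gamma>\<in>belief_bases L. models L \<Gamma> \<noteq> {} \<longrightarrow> min_set (models L \<Gamma>) r \<noteq> {})"

type_synonym ('s, 'w) assignment = "'s set \<Rightarrow> 'w rel"

definition is_assignment :: "('s, 'w) logic \<Rightarrow> ('s, 'w) assignment \<Rightarrow> bool" where
  "is_assignment L R \<longleftrightarrow> (\<forall>K\<in>belief_bases L. total_rel_on (interpretations L) (R K))"

definition preorder_assignment :: "('s, 'w) logic \<Rightarrow> ('s, 'w) assignment \<Rightarrow> bool" where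
  "preorder_assignment L R \<longleftrightarrow>
    is_assignment L R \<and> (\<forall>K\<in>belief_bases L. preorder_on (interpretations L) (R K))"

definition min_complete_assignment :: "('s, 'w) logic \<Rightarrow> ('s, 'w) assignment \<Rightarrow> bool" where
  "min_complete_assignment L R \<longleftrightarrow>
    is_assignment L R \<and> (\<forall>K\<in>belief_bases L. min_complete L (R K))"

definition F1 :: "('s, 'w) logic \<Rightarrow> ('s, 'w) assignment \<Rightarrow> bool" where
  "F1 L R \<longleftrightarrow>
    (\<forall>K\<in>belief_bases L. \<forall>\<omega>\<in>interpretations L. \<forall>\<omega>'\<in>interpretations L.
      \<omega> \<in> models L K \<and> \<omega>' \<in> models L K \<longrightarrow> \<not> strictly_below (R K) \<omega> \<omega>')"

definition F2 :: "('s, 'w) logic \<Rightarrow> ('s, 'w) assignment \<Rightarrow> bool" where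
  "F2 L R \<longleftrightarrow>
    (\<forall>K\<in>belief_bases L. \<forall>\<omega>\<in>interpretations L. \<forall>\<omega>'\<in>interpretations L.
      \<omega> \<in> models L K \<and> \<omega>' \<notin> models L K \<longrightarrow> strictly_below (R K) \<omega> \<omega>')"

definition F3 :: "('s, 'w) logic \<Rightarrow> ('s, 'w) assignment \<Rightarrow> bool" where
  "F3 L R \<longleftrightarrow>
    (\<forall>K\<in>belief_bases L. \<forall>K'\<in>belief_bases L. base_equiv L K K' \<longrightarrow> R K = R K')"

definition faithful_assignment :: "('s, 'w) logic \<Rightarrow> ('s, 'w) assignment \<Rightarrow> bool" where
  "faithful_assignment L R \<longleftrightarrow> is_assignment L R \<and> F1 L R \<and> F2 L R \<and> F3 L R"

definition compatible :: "('s, 'w) logic \<Rightarrow> 's base_op \<Rightarrow> ('s, 'w) assignment \<Rightarrow> bool" where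
  "compatible L chg R \<longleftrightarrow>
    (\<forall>K\<in>belief_bases L. \<forall>\<Gamma>\<in>belief_bases L.
      models L (chg K \<Gamma>) = min_set (models L \<Gamma>) (R K))"

definition total_preorder_representable :: "('s, 'w) logic \<Rightarrow> 's base_op \<Rightarrow> bool" where
  "total_preorder_representable L chg \<longleftrightarrow>
    (\<exists>R. min_complete_assignment L R \<and> faithful_assignment L R \<and> preorder_assignment L R \<and>
      compatible L chg R)"

end

theory Submission
  imports Defs
begin

text \<open>
  Fix a base \<open>K\<close> and say that \<open>x\<close> is revealed below \<open>y\<close> if some input having \<open>y\<close> as a model is
  changed into a base having \<open>x\<close> as a model. Closure under unions makes this relation transitive:
  given two inputs witnessing two consecutive steps, the result of their disjunction must meet one
  of them, and (G5), (G6) then transfer the minimal elements. The same argument compares any two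
  interpretations that are each selected by some input. An interpretation selected by no input is
  never minimal, so all of these can be put into one class at the top of the order.
\<close>

definition revealed_below ::
  "('s, 'w) logic \<Rightarrow> 's base_op \<Rightarrow> 's set \<Rightarrow> 'w \<Rightarrow> 'w \<Rightarrow> bool" where
  "revealed_below L chg K x y \<longleftrightarrow>
    (\<exists>\<Gamma>\<in>belief_bases L. x \<in> models L (chg K \<Gamma>) \<and> y \<in> models L \<Gamma>)"

text \<open>By (G1), \<open>y\<close> is revealed below itself exactly if some input selects it.\<close>

definition revealed_preorder :: "('s, 'w) logic \<Rightarrow> 's base_op \<Rightarrow> ('s, 'w) assignment" where
  "revealed_preorder L chg K =
    {(x, y) \<in> interpretations L \<times> interpretations L.
      revealed_below L chg K y y \<longrightarrow> revealed_below L chg K x y}"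

lemma empty_belief_base [simp]: "{} \<in> belief_bases L"
  by (simp add: belief_bases_def)

lemma Un_belief_base [simp]:
  "\<lbrakk>\<Gamma>1 \<in> belief_bases L; \<Gamma>2 \<in> belief_bases L\<rbrakk> \<Longrightarrow> \<Gamma>1 \<union> \<Gamma>2 \<in> belief_bases L"
  by (simp add: belief_bases_def)

lemma models_empty [simp]: "models L {} = interpretations L"
  by (simp add: models_def)

lemma models_Un: "models L (\<Gamma>1 \<union> \<Gamma>2) = models L \<Gamma>1 \<inter> models L \<Gamma>2"
  by (auto simp: models_def)

lemma models_subset: "models L \<Gamma> \<subseteq> interpretations L"
  by (auto simp: models_def)

locale revision_operator =
  fixes L :: "('s, 'w) logic" and chg :: "'s base_op"
  assumes disj: "disjunctive L"
    and g1: "G1 L chg" and g2: "G2 L chg" and g3: "G3 L chg"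
    and g4: "G4 L chg" and g5: "G5 L chg" and g6: "G6 L chg"
begin

lemma success:
  "\<lbrakk>K \<in> belief_bases L; \<Gamma> \<in> belief_bases L\<rbrakk> \<Longrightarrow> models L (chg K \<Gamma>) \<subseteq> models L \<Gamma>"
  using g1 by (auto simp: G1_def base_entails_def)

lemma consistency:
  "\<lbrakk>K \<in> belief_bases L; \<Gamma> \<in> belief_bases L; models L \<Gamma> \<noteq> {}\<rbrakk> \<Longrightarrow> models L (chg K \<Gamma>) \<noteq> {}"
  using g3 by (auto simp: G3_def)

lemma models_chg_cong:
  assumes "K1 \<in> belief_bases L" "K2 \<in> belief_bases L" "\<Gamma>1 \<in> belief_bases L" "\<Gamma>2 \<in> belief_bases L"
    and "models L K1 = models L K2" "models L \<Gamma>1 = models L \<Gamma>2"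
  shows "models L (chg K1 \<Gamma>1) = models L (chg K2 \<Gamma>2)"
  using g4 assms unfolding G4_def base_equiv_def by blast

text \<open>(G5) gives one inclusion outright. The nonemptiness assumption is the premise of (G6),
  which gives the other.\<close>

lemma models_chg_Un:
  assumes "K \<in> belief_bases L" "\<Gamma>1 \<in> belief_bases L" "\<Gamma>2 \<in> belief_bases L"
    and "models L (chg K \<Gamma>1) \<inter> models L \<Gamma>2 \<noteq> {}"
  shows "models L (chg K (\<Gamma>1 \<union> \<Gamma>2)) = models L (chg K \<Gamma>1) \<inter> models L \<Gamma>2"
  using g5 g6 assms unfolding G5_def G6_def base_entails_def models_Un by blast

text \<open>When \<open>\<Delta>\<close> entails \<open>\<Gamma>\<close>, the input
  \<open>\<Gamma> \<union> \<Delta>\<close> is equivalent to \<open>\<Delta>\<close>, so (G4)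
  removes the union from \<open>models_chg_Un\<close>.\<close>

lemma models_chg_subset:
  assumes "K \<in> belief_bases L" "\<Gamma> \<in> belief_bases L" "\<Delta> \<in> belief_bases L"
    and "models L \<Delta> \<subseteq> models L \<Gamma>" "models L (chg K \<Gamma>) \<inter> models L \<Delta> \<noteq> {}"
  shows "models L (chg K \<Delta>) = models L (chg K \<Gamma>) \<inter> models L \<Delta>"
proof -
  have "models L (\<Gamma> \<union> \<Delta>) = models L \<Delta>"
    using assms(4) by (auto simp: models_Un)
  then show ?thesis
    using models_chg_Un[OF assms(1-3,5)] models_chg_cong[of K K "\<Gamma> \<union> \<Delta>" \<Delta>] assms(1-3) by simp
qed

text \<open>The disjunction is consistent, so its result is nonempty by (G3) and meets a disjunct by
  (G1). A disjunct that is met has its whole selection inside the result. The last conjunct records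
  this for \<open>\<Gamma>1\<close> separately, as transitivity needs it.\<close>

lemma disjunction_selection:
  assumes "K \<in> belief_bases L" "\<Gamma>1 \<in> belief_bases L" "\<Gamma>2 \<in> belief_bases L"
    and "models L \<Gamma>1 \<union> models L \<Gamma>2 \<noteq> {}"
  shows "\<exists>\<Delta>\<in>belief_bases L. models L \<Delta> = models L \<Gamma>1 \<union> models L \<Gamma>2 \<and>
    (models L (chg K \<Gamma>1) \<subseteq> models L (chg K \<Delta>) \<or>
      models L (chg K \<Gamma>2) \<subseteq> models L (chg K \<Delta>)) \<and>
    (models L (chg K \<Delta>) \<inter> models L \<Gamma>1 \<noteq> {} \<longrightarrow>
      models L (chg K \<Gamma>1) \<subseteq> models L (chg K \<Delta>))"
proof -
  obtain \<Delta> where \<Delta>: "\<Delta> \<in> belief_bases L" "models L \<Delta> = models L \<Gamma>1 \<union> models L \<Gamma>2"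
    using disj assms(2,3) unfolding disjunctive_def by blast
  have 1: "models L (chg K \<Delta>) \<inter> models L \<Gamma>1 \<noteq> {} \<Longrightarrow> models L (chg K \<Gamma>1) \<subseteq> models L (chg K \<Delta>)"
    using models_chg_subset[of K \<Delta> \<Gamma>1] assms \<Delta> by auto
  have 2: "models L (chg K \<Delta>) \<inter> models L \<Gamma>2 \<noteq> {} \<Longrightarrow> models L (chg K \<Gamma>2) \<subseteq> models L (chg K \<Delta>)"
    using models_chg_subset[of K \<Delta> \<Gamma>2] assms \<Delta> by auto
  have "models L (chg K \<Delta>) \<noteq> {}" "models L (chg K \<Delta>) \<subseteq> models L \<Gamma>1 \<union> models L \<Gamma>2"
    using consistency[of K \<Delta>] success[of K \<Delta>] assms \<Delta> by auto
  then have "models L (chg K \<Delta>) \<inter> models L \<Gamma>1 \<noteq> {} \<or> models L (chg K \<Delta>) \<inter> models L \<Gamma>2 \<noteq> {}"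
    by blast
  then show ?thesis
    using \<Delta> 1 2 by blast
qed

lemma revealed_below_trans:
  assumes K: "K \<in> belief_bases L"
    and "revealed_below L chg K x y" "revealed_below L chg K y z"
  shows "revealed_below L chg K x z"
proof -
  obtain \<Gamma>1 \<Gamma>2 where \<Gamma>: "\<Gamma>1 \<in> belief_bases L" "\<Gamma>2 \<in> belief_bases L"
    and xy: "x \<in> models L (chg K \<Gamma>1)" "y \<in> models L \<Gamma>1"
    and yz: "y \<in> models L (chg K \<Gamma>2)" "z \<in> models L \<Gamma>2"
    using assms unfolding revealed_below_def by blast
  obtain \<Delta> where \<Delta>: "\<Delta> \<in> belief_bases L" "models L \<Delta> = models L \<Gamma>1 \<union> models L \<Gamma>2"
    and cases: "models L (chg K \<Gamma>1) \<subseteq> models L (chg K \<Delta>) \<or> models L (chg K \<Gamma>2) \<subseteq> models L (chg K \<Delta>)"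
    and meet: "models L (chg K \<Delta>) \<inter> models L \<Gamma>1 \<noteq> {} \<longrightarrow>
      models L (chg K \<Gamma>1) \<subseteq> models L (chg K \<Delta>)"
    using disjunction_selection[OF K \<Gamma>] xy(2) by auto
  \<comment> \<open>If the selection of \<open>\<Gamma>2\<close> is the one included, then
    \<open>y\<close> is selected by \<open>\<Delta>\<close> and is a model of
    \<open>\<Gamma>1\<close>, so \<open>meet\<close> brings in the selection of
    \<open>\<Gamma>1\<close> as well.\<close>
  have "x \<in> models L (chg K \<Delta>)"
    using cases meet xy yz by blast
  then show ?thesis
    using \<Delta> yz(2) unfolding revealed_below_def by blast
qed

lemma revealed_below_refl_left:
  "\<lbrakk>K \<in> belief_bases L; revealed_below L chg K x y\<rbrakk> \<Longrightarrow> revealed_below L chg K x x"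
  using success unfolding revealed_below_def by blast

text \<open>Both points are models of the disjunction of inputs selecting them, and that disjunction
  selects at least one of the two.\<close>

lemma revealed_below_linear:
  assumes K: "K \<in> belief_bases L"
    and "revealed_below L chg K x x" "revealed_below L chg K y y"
  shows "revealed_below L chg K x y \<or> revealed_below L chg K y x"
proof -
  obtain \<Gamma>1 \<Gamma>2 where \<Gamma>: "\<Gamma>1 \<in> belief_bases L" "\<Gamma>2 \<in> belief_bases L"
    and x: "x \<in> models L (chg K \<Gamma>1)" and y: "y \<in> models L (chg K \<Gamma>2)"
    using assms unfolding revealed_below_def by blast
  have xy: "x \<in> models L \<Gamma>1" "y \<in> models L \<Gamma>2"
    using success[OF K \<Gamma>(1)] success[OF K \<Gamma>(2)] x y by auto
  obtain \<Delta> where "\<Delta> \<in> belief_bases L" "models L \<Delta> = models L \<Gamma>1 \<union> models L \<Gamma>2"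
    "models L (chg K \<Gamma>1) \<subseteq> models L (chg K \<Delta>) \<or> models L (chg K \<Gamma>2) \<subseteq> models L (chg K \<Delta>)"
    using disjunction_selection[OF K \<Gamma>] xy by auto
  then show ?thesis
    using x y xy unfolding revealed_below_def by blast
qed

text \<open>Linearity covers pairs of selectable points; if one point is never selected, placing the
  other below it holds vacuously.\<close>

lemma total_revealed_preorder:
  "K \<in> belief_bases L \<Longrightarrow> total_rel_on (interpretations L) (revealed_preorder L chg K)"
  using revealed_below_linear by (auto simp: total_rel_on_def revealed_preorder_def)

lemma trans_revealed_preorder:
  assumes K: "K \<in> belief_bases L"
  shows "trans (revealed_preorder L chg K)"
proof (rule transI)
  fix x y z
  assume "(x, y) \<in> revealed_preorder L chg K" "(y, z) \<in> revealed_preorder L chg K"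
  then show "(x, z) \<in> revealed_preorder L chg K"
    \<comment> \<open>If \<open>z\<close> is selectable, \<open>y\<close> is revealed below it and
      hence selectable too, so both hypotheses become revealed comparisons.\<close>
    using revealed_below_trans[OF K, of x y z] revealed_below_refl_left[OF K, of y z]
    by (auto simp: revealed_preorder_def)
qed

lemma preorder_revealed_preorder:
  assumes "K \<in> belief_bases L"
  shows "preorder_on (interpretations L) (revealed_preorder L chg K)"
  using total_revealed_preorder[OF assms] trans_revealed_preorder[OF assms]
  unfolding preorder_on_def refl_on_def total_rel_on_def by blast

text \<open>A selected point is minimal because \<open>\<Gamma>\<close> itself witnesses every
  comparison. Conversely, a minimal point is compared with some selected one, and the witnessing
  input is conjoined with \<open>\<Gamma>\<close>.\<close>

lemma min_set_revealed_preorder: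
  assumes K: "K \<in> belief_bases L" and \<Gamma>: "\<Gamma> \<in> belief_bases L"
  shows "min_set (models L \<Gamma>) (revealed_preorder L chg K) = models L (chg K \<Gamma>)"
proof (intro equalityI subsetI)
  fix x
  assume "x \<in> models L (chg K \<Gamma>)"
  then show "x \<in> min_set (models L \<Gamma>) (revealed_preorder L chg K)"
    using success[OF K \<Gamma>] models_subset[of L \<Gamma>] \<Gamma>
    unfolding min_set_def revealed_preorder_def revealed_below_def by blast
next
  fix x
  assume x: "x \<in> min_set (models L \<Gamma>) (revealed_preorder L chg K)"
  then have x\<Gamma>: "x \<in> models L \<Gamma>"
    by (simp add: min_set_def)
  then obtain y where y: "y \<in> models L (chg K \<Gamma>)" "y \<in> models L \<Gamma>"
    using consistency[OF K \<Gamma>] success[OF K \<Gamma>] by blast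
  then have "revealed_below L chg K y y"
    using \<Gamma> unfolding revealed_below_def by blast
  then have "revealed_below L chg K x y"
    using x y(2) unfolding min_set_def revealed_preorder_def by blast
  then obtain \<Delta> where \<Delta>: "\<Delta> \<in> belief_bases L" "x \<in> models L (chg K \<Delta>)" "y \<in> models L \<Delta>"
    unfolding revealed_below_def by blast
  \<comment> \<open>The joint input is evaluated in both orders: \<open>y\<close> makes the first
    intersection nonempty and \<open>x\<close> the second. Their equality puts \<open>x\<close> into
    the selection of \<open>\<Gamma>\<close>.\<close>
  have "models L (chg K (\<Gamma> \<union> \<Delta>)) = models L (chg K \<Gamma>) \<inter> models L \<Delta>"
    using models_chg_Un[OF K \<Gamma> \<Delta>(1)] y \<Delta> by blast
  moreover have "models L (chg K (\<Delta> \<union> \<Gamma>)) = models L (chg K \<Delta>) \<inter> models L \<Gamma>"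
    using models_chg_Un[OF K \<Delta>(1) \<Gamma>] x\<Gamma> \<Delta> by blast
  ultimately show "x \<in> models L (chg K \<Gamma>)"
    using x\<Gamma> \<Delta>(2) by (auto simp: Un_commute)
qed

text \<open>The empty base is the input that every interpretation satisfies; for it, (G2) returns
  the models of a consistent \<open>K\<close>. Both (F1) and (F2) follow from this.\<close>

lemma min_set_interpretations:
  assumes K: "K \<in> belief_bases L" and "models L K \<noteq> {}"
  shows "min_set (interpretations L) (revealed_preorder L chg K) = models L K"
proof -
  have "models L (chg K {}) = models L K"
    using g2 assms empty_belief_base[of L] unfolding G2_def base_equiv_def by fastforce
  then show ?thesis
    using min_set_revealed_preorder[OF K empty_belief_base] by simp
qed

lemma faithful_revealed_preorder: "faithful_assignment L (revealed_preorder L chg)"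
proof -
  have "F1 L (revealed_preorder L chg)"
    unfolding F1_def
  proof (intro ballI impI)
    fix K x y
    assume "K \<in> belief_bases L" and xy: "x \<in> models L K \<and> y \<in> models L K"
    then have "min_set (interpretations L) (revealed_preorder L chg K) = models L K"
      using min_set_interpretations by blast
    then show "\<not> strictly_below (revealed_preorder L chg K) x y"
      using xy unfolding min_set_def strictly_below_def by blast
  qed
  moreover have "F2 L (revealed_preorder L chg)"
    unfolding F2_def
  proof (intro ballI impI)
    fix K x y
    assume K: "K \<in> belief_bases L" and x: "x \<in> interpretations L" and y: "y \<in> interpretations L"
      and xy: "x \<in> models L K \<and> y \<notin> models L K"
    let ?R = "revealed_preorder L chg K"
    have min: "min_set (interpretations L) ?R = models L K"
      using min_set_interpretations K xy by blast
    then have below: "\<forall>z\<in>interpretations L. (x, z) \<in> ?R"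
      using xy unfolding min_set_def by blast
    have "(y, x) \<notin> ?R"
    proof
      assume "(y, x) \<in> ?R"
      \<comment> \<open>Being below the globally minimal \<open>x\<close> would make
        \<open>y\<close> globally minimal, hence a model of \<open>K\<close>.\<close>
      then have "\<forall>z\<in>interpretations L. (y, z) \<in> ?R"
        using below trans_revealed_preorder[OF K] by (meson transD)
      then show False
        using min xy y unfolding min_set_def by blast
    qed
    then show "strictly_below ?R x y"
      using below y unfolding strictly_below_def by blast
  qed
  moreover have "F3 L (revealed_preorder L chg)"
    unfolding F3_def base_equiv_def
  proof (intro ballI impI)
    fix K K'
    assume "K \<in> belief_bases L" "K' \<in> belief_bases L" "models L K = models L K'"
    then have "\<forall>\<Gamma>\<in>belief_bases L. models L (chg K \<Gamma>) = models L (chg K' \<Gamma>)"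
      using models_chg_cong by blast
    \<comment> \<open>The relation depends on \<open>K\<close> only through the models of
      \<open>chg K \<Gamma>\<close>, so (G4) yields equality of relations.\<close>
    then show "revealed_preorder L chg K = revealed_preorder L chg K'"
      by (simp add: revealed_preorder_def revealed_below_def)
  qed
  ultimately show ?thesis
    using total_revealed_preorder by (simp add: faithful_assignment_def is_assignment_def)
qed

lemma representable: "total_preorder_representable L chg"
  unfolding total_preorder_representable_def
proof (intro exI conjI)
  show "min_complete_assignment L (revealed_preorder L chg)"
    using total_revealed_preorder min_set_revealed_preorder consistency
    by (simp add: min_complete_assignment_def is_assignment_def min_complete_def)
  show "faithful_assignment L (revealed_preorder L chg)"
    by (rule faithful_revealed_preorder)
  show "preorder_assignment L (revealed_preorder L chg)"
    using total_revealed_preorder preorder_revealed_preorder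
    by (simp add: preorder_assignment_def is_assignment_def)
  show "compatible L chg (revealed_preorder L chg)"
    using min_set_revealed_preorder by (simp add: compatible_def)
qed

end

theorem corollary14:
  fixes L :: "('s, 'w) logic"
    and chg :: "'s base_op"
  assumes "disjunctive L"
    and "base_change_operator L chg"
    and "G1 L chg" and "G2 L chg" and "G3 L chg"
    and "G4 L chg" and "G5 L chg" and "G6 L chg"
  shows "total_preorder_representable L chg"
  using assms by (intro revision_operator.representable revision_operator.intro)

end
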